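(* Let $k\ge 2$. The set $S_\alpha=\{\alpha_0,\alpha_1,\alpha_2,\ldots,\alpha_{k-2},\tau\}$ of elements of $\mathrm{Aut}\,X^{[k]}$ generates a group $G_k$ which is isomorphic to a Sylow 2-subgroup of the alternating group $A_{2^k}$.
   Context: $X^{[k]}$ is the rooted binary tree with levels $X^0,X^1,\ldots,X^k$. Level $X^j$ consists of $2^j$ vertices $v_{j,1},\ldots,v_{j,2^j}$ numbered from left to right, so the children of $v_{j,i}$ ($j<k$) are $v_{j+1,2i-1}$ and $v_{j+1,2i}$. An automorphism $g\in\mathrm{Aut}\,X^{[k]}$ (fixing the root) is determined by its portrait: for every vertex $v_{j,i}$ with $0\le j\le k-1$, if $g(v_{j,i})=v_{j,m}$, then the state of $g$ at $v_{j,i}$ is trivial if $g(v_{j+1,2i-1})=v_{j+1,2m-1}$, and non-trivial (active) if $g(v_{j+1,2i-1})=v_{j+1,2m}$. Any assignment of trivial/active states to the vertices of levels $0,\ldots,k-1$ is the portrait of a unique automorphism. For $0\le l\le k-2$, $\alpha_l$ is the automorphism whose only active state is at $v_{l,1}$. The automorphism $\tau=\tau_{1,2^{k-1}}$ has active states exactly at $v_{k-1,1}$ and $v_{k-1,2^{k-1}}$. *)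

theory Defs
  imports "HOL-Algebra.Sym_Groups" "HOL-Computational_Algebra.Primes"
begin

section \<open>The rooted binary tree and its automorphism group\<close>

text \<open>The pair \<open>(j, i)\<close> stands for \<open>v\<^sub>j\<^sub>,\<^sub>i\<close>, the \<open>i\<close>-th vertex from the left of level \<open>j\<close>;
  the numbering of a level starts at 1.\<close>

type_synonym vertex = "nat \<times> nat"

definition tree_vertices :: "nat \<Rightarrow> vertex set" where
  "tree_vertices k = {(j, i). j \<le> k \<and> i \<in> {1..2 ^ j}}"

definition tree_root :: vertex where
  "tree_root = (0, 1)"

definition child_of :: "vertex \<Rightarrow> vertex \<Rightarrow> bool" where
  "child_of u v \<longleftrightarrow> fst u = Suc (fst v) \<and> (snd u = 2 * snd v - 1 \<or> snd u = 2 * snd v)"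

definition tree_adj :: "vertex \<Rightarrow> vertex \<Rightarrow> bool" where
  "tree_adj u v \<longleftrightarrow> child_of u v \<or> child_of v u"

text \<open>As in the library's \<open>sym_group\<close>, an automorphism is extended by the identity to arguments
  that are not vertices of the tree, so that equality of automorphisms is equality of functions.
  That it preserves the levels is not part of the definition but a consequence
  (\<open>tree_aut_level\<close>).\<close>

definition tree_auts :: "nat \<Rightarrow> (vertex \<Rightarrow> vertex) set" where
  "tree_auts k = {g. g permutes tree_vertices k \<and> g tree_root = tree_root \<and>
     (\<forall>u\<in>tree_vertices k. \<forall>v\<in>tree_vertices k. tree_adj (g u) (g v) \<longleftrightarrow> tree_adj u v)}"

definition tree_aut_group :: "nat \<Rightarrow> (vertex \<Rightarrow> vertex) monoid" where
  "tree_aut_group k = \<lparr>carrier = tree_auts k, mult = (\<circ>), one = id\<rparr>"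

text \<open>The portrait of \<open>g\<close>, given as the set of vertices at which the state of \<open>g\<close> is active.\<close>

definition active_vertices :: "nat \<Rightarrow> (vertex \<Rightarrow> vertex) \<Rightarrow> vertex set" where
  "active_vertices k g = {(j, i). j < k \<and> i \<in> {1..2 ^ j} \<and>
     (\<exists>m. g (j, i) = (j, m) \<and> g (Suc j, 2 * i - 1) = (Suc j, 2 * m))}"

text \<open>Such an automorphism exists and is unique when \<open>A\<close> consists of vertices of the
  levels \<open>0, \<dots>, k - 1\<close>; see \<open>ex1_aut_with_portrait\<close> below.\<close>

definition aut_with_portrait :: "nat \<Rightarrow> vertex set \<Rightarrow> vertex \<Rightarrow> vertex" where
  "aut_with_portrait k A = (THE g. g \<in> tree_auts k \<and> active_vertices k g = A)"

definition alpha :: "nat \<Rightarrow> nat \<Rightarrow> vertex \<Rightarrow> vertex" where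
  "alpha k l = aut_with_portrait k {(l, 1)}"

definition tau :: "nat \<Rightarrow> vertex \<Rightarrow> vertex" where
  "tau k = aut_with_portrait k {(k - 1, 1), (k - 1, 2 ^ (k - 1))}"

definition S_alpha :: "nat \<Rightarrow> (vertex \<Rightarrow> vertex) set" where
  "S_alpha k = alpha k ` {0..k - 2} \<union> {tau k}"

definition G_alpha :: "nat \<Rightarrow> (vertex \<Rightarrow> vertex) monoid" where
  "G_alpha k = (tree_aut_group k)\<lparr>carrier := generate (tree_aut_group k) (S_alpha k)\<rparr>"

text \<open>For a finite group \<open>G\<close> and a prime \<open>p\<close>.\<close>

definition sylow_subgroup :: "nat \<Rightarrow> ('a, 'b) monoid_scheme \<Rightarrow> 'a set \<Rightarrow> bool" where
  "sylow_subgroup p G P \<longleftrightarrow> subgroup P G \<and> card P = p ^ multiplicity p (order G)"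


section \<open>Well-definedness\<close>

lemma finite_tree_vertices: "finite (tree_vertices k)"
proof (rule finite_subset)
  show "tree_vertices k \<subseteq> {0..k} \<times> {1..2 ^ k}"
  proof clarify
    fix j i assume "(j, i) \<in> tree_vertices k"
    then have "j \<le> k" "1 \<le> i" "i \<le> 2 ^ j" by (auto simp: tree_vertices_def)
    moreover have "(2::nat) ^ j \<le> 2 ^ k" using \<open>j \<le> k\<close> by simp
    ultimately show "j \<in> {0..k} \<and> i \<in> {1..2 ^ k}"
      unfolding atLeastAtMost_iff using order_trans by blast
  qed
qed simp

lemma parent_in_tree:
  assumes "(Suc j, i) \<in> tree_vertices k"
  shows "(j, (i + 1) div 2) \<in> tree_vertices k" "child_of (Suc j, i) (j, (i + 1) div 2)"
  using assms by (auto simp: tree_vertices_def child_of_def)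

lemma child_of_iff:
  assumes "1 \<le> i"
  shows "child_of (j', i') (j, i) \<longleftrightarrow> j' = Suc j \<and> i = (i' + 1) div 2"
  using assms by (auto simp: child_of_def)

lemma tree_aut_level:
  assumes g: "g \<in> tree_auts k" and "(j, i) \<in> tree_vertices k"
  shows "fst (g (j, i)) = j"
  using assms(2)
proof (induction j arbitrary: i rule: less_induct)
  case (less j)
  have perm: "g permutes tree_vertices k" and root: "g (0, 1) = (0, 1)"
    and adj: "\<And>u v. u \<in> tree_vertices k \<Longrightarrow> v \<in> tree_vertices k \<Longrightarrow> tree_adj u v \<Longrightarrow>
               tree_adj (g u) (g v)"
    using g by (auto simp: tree_auts_def tree_root_def)
  have inV: "g u \<in> tree_vertices k" if "u \<in> tree_vertices k" for u
    using perm that by (simp add: permutes_in_image)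
  show ?case
  proof (cases j)
    case 0
    then have "i = 1" using less.prems by (auto simp: tree_vertices_def)
    then show ?thesis using 0 root by simp
  next
    case (Suc j0)
    define v where "v = (j, i)"
    define u where "u = (j0, (i + 1) div 2)"
    have v: "v \<in> tree_vertices k" and u: "u \<in> tree_vertices k" and vu: "child_of v u"
      using less.prems parent_in_tree[of j0 i k] Suc by (auto simp: v_def u_def)
    have lu: "fst (g u) = j0" using less.IH[of j0] u Suc by (simp add: u_def)
    have "tree_adj (g v) (g u)" using adj v u vu by (auto simp: tree_adj_def)
    moreover have "\<not> child_of (g u) (g v)"
    proof
      assume uv: "child_of (g u) (g v)"
      then obtain j1 where j1: "j0 = Suc j1" "fst (g v) = j1"
        using lu by (auto simp: child_of_def)
      define w where "w = (j1, ((i + 1) div 2 + 1) div 2)"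
      have w: "w \<in> tree_vertices k" and uw: "child_of u w"
        using parent_in_tree[of j1 "(i + 1) div 2" k] u j1(1) by (auto simp: w_def u_def)
      have lw: "fst (g w) = j1" using less.IH[of j1] w Suc j1(1) by (simp add: w_def)
      have "tree_adj (g u) (g w)" using adj u w uw by (auto simp: tree_adj_def)
      then have "child_of (g u) (g w)" using lu lw j1(1) by (auto simp: tree_adj_def child_of_def)
      then have "g w = g v"
        using uv inV[OF v] inV[OF w] child_of_iff[of "snd (g v)" "fst (g u)" "snd (g u)" "fst (g v)"]
          child_of_iff[of "snd (g w)" "fst (g u)" "snd (g u)" "fst (g w)"] j1 lw
        by (auto simp: tree_vertices_def intro!: prod_eqI)
      then have "w = v" using permutes_inj[OF perm] by (auto dest: injD)
      then show False using Suc j1 by (auto simp: w_def v_def)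
    qed
    ultimately have "child_of (g v) (g u)" by (auto simp: tree_adj_def)
    then show ?thesis using lu Suc by (simp add: child_of_def v_def)
  qed
qed

lemma tree_aut_child:
  assumes g: "g \<in> tree_auts k" and "(Suc j, i) \<in> tree_vertices k"
  shows "child_of (g (Suc j, i)) (g (j, (i + 1) div 2))"
proof -
  have "tree_adj (g (Suc j, i)) (g (j, (i + 1) div 2))"
    using g parent_in_tree[OF assms(2)] assms(2) by (auto simp: tree_auts_def tree_adj_def)
  then show ?thesis
    using tree_aut_level[OF g assms(2)] tree_aut_level[OF g parent_in_tree(1)[OF assms(2)]]
    by (auto simp: tree_adj_def child_of_def)
qed

lemma portrait_unique:
  assumes g: "g \<in> tree_auts k" and h: "h \<in> tree_auts k"
    and eq: "active_vertices k g = active_vertices k h"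
  shows "g = h"
proof -
  have pg: "g permutes tree_vertices k" and ph: "h permutes tree_vertices k"
    using g h by (auto simp: tree_auts_def)
  have *: "g (j, i) = h (j, i)" if "(j, i) \<in> tree_vertices k" for j i
    using that
  proof (induction j arbitrary: i)
    case 0
    then have "i = 1" by (auto simp: tree_vertices_def)
    then show ?case using g h by (auto simp: tree_auts_def tree_root_def)
  next
    case (Suc j)
    define p where "p = (i + 1) div 2"
    have p: "(j, p) \<in> tree_vertices k" and jk: "j < k" and p1: "1 \<le> p" "p \<le> 2 ^ j"
      using parent_in_tree[OF Suc.prems] Suc.prems by (auto simp: p_def tree_vertices_def)
    obtain m where gm: "g (j, p) = (j, m)"
      using tree_aut_level[OF g p] by (metis prod.collapse)
    have hm: "h (j, p) = (j, m)" using Suc.IH[OF p] gm by simp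
    have "(j, m) \<in> tree_vertices k" using pg p gm by (metis permutes_in_image)
    then have m1: "1 \<le> m" by (auto simp: tree_vertices_def)
    have odd_in: "(Suc j, 2 * p - 1) \<in> tree_vertices k"
      and even_in: "(Suc j, 2 * p) \<in> tree_vertices k"
      using p1 jk by (auto simp: tree_vertices_def)
    have odd_val: "f (Suc j, 2 * p - 1) = (Suc j, if (j, p) \<in> active_vertices k f then 2 * m else 2 * m - 1)"
      and even_val: "f (Suc j, 2 * p) = (Suc j, if (j, p) \<in> active_vertices k f then 2 * m - 1 else 2 * m)"
      if f: "f \<in> tree_auts k" and fm: "f (j, p) = (j, m)" for f
    proof -
      have div1: "(2 * p - 1 + 1) div 2 = p" "(2 * p + 1) div 2 = p" using p1 by auto
      have c1: "child_of (f (Suc j, 2 * p - 1)) (j, m)"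
        using tree_aut_child[OF f odd_in] fm unfolding div1 by simp
      have c2: "child_of (f (Suc j, 2 * p)) (j, m)"
        using tree_aut_child[OF f even_in] fm unfolding div1 by simp
      have inj: "inj f" using f by (auto simp: tree_auts_def dest: permutes_inj)
      have ne: "f (Suc j, 2 * p - 1) \<noteq> f (Suc j, 2 * p)"
        using inj_eq[OF inj] p1 by auto
      have act: "(j, p) \<in> active_vertices k f \<longleftrightarrow> f (Suc j, 2 * p - 1) = (Suc j, 2 * m)"
        using jk p1 fm by (auto simp: active_vertices_def)
      show odd: "f (Suc j, 2 * p - 1) = (Suc j, if (j, p) \<in> active_vertices k f then 2 * m else 2 * m - 1)"
        using c1 act by (auto simp: child_of_def prod_eq_iff)
      show "f (Suc j, 2 * p) = (Suc j, if (j, p) \<in> active_vertices k f then 2 * m - 1 else 2 * m)"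
        using c2 ne odd by (auto simp: child_of_def prod_eq_iff split: if_splits)
    qed
    have "i = 2 * p - 1 \<or> i = 2 * p"
      using parent_in_tree(2)[OF Suc.prems] by (auto simp: child_of_def p_def)
    then show ?case
      using odd_val[OF g gm] odd_val[OF h hm] even_val[OF g gm] even_val[OF h hm] eq by auto
  qed
  show ?thesis
  proof
    fix v
    show "g v = h v"
      using * permutes_not_in[OF pg] permutes_not_in[OF ph] by (cases v) metis
  qed
qed

fun portrait_map :: "vertex set \<Rightarrow> nat \<Rightarrow> nat \<Rightarrow> nat" where
  "portrait_map A 0 i = i"
| "portrait_map A (Suc j) i =
     (let p = (i + 1) div 2; m = portrait_map A j p
      in if odd i \<longleftrightarrow> (j, p) \<in> A then 2 * m else 2 * m - 1)"

lemma parent_index: "(i::nat) \<in> {1..2 ^ Suc j} \<Longrightarrow> (i + 1) div 2 \<in> {1..2 ^ j}"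
  by auto

lemma portrait_map_Suc:
  "portrait_map A (Suc j) i \<in> {2 * portrait_map A j ((i + 1) div 2) - 1, 2 * portrait_map A j ((i + 1) div 2)}"
  by (cases "odd i \<longleftrightarrow> (j, (i + 1) div 2) \<in> A")
    (simp_all only: portrait_map.simps Let_def if_True if_False insert_iff simp_thms)

lemma portrait_map_in: "i \<in> {1..2 ^ j} \<Longrightarrow> portrait_map A j i \<in> {1..2 ^ j}"
proof (induction j arbitrary: i)
  case 0
  then show ?case by simp
next
  case (Suc j)
  define m where "m = portrait_map A j ((i + 1) div 2)"
  have "m \<ge> 1" "m \<le> 2 ^ j"
    using Suc.IH[OF parent_index[OF Suc.prems]] by (simp_all add: m_def)
  moreover have "portrait_map A (Suc j) i = 2 * m - 1 \<or> portrait_map A (Suc j) i = 2 * m"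
    using portrait_map_Suc[of A j i] by (simp only: m_def insert_iff empty_iff) blast
  ultimately have "1 \<le> portrait_map A (Suc j) i" "portrait_map A (Suc j) i \<le> 2 * 2 ^ j"
    by linarith+
  then show ?case by (simp only: atLeastAtMost_iff power_Suc simp_thms)
qed

lemma portrait_map_parent:
  assumes "i \<in> {1..2 ^ Suc j}"
  shows "(portrait_map A (Suc j) i + 1) div 2 = portrait_map A j ((i + 1) div 2)"
proof -
  define m where "m = portrait_map A j ((i + 1) div 2)"
  have "m \<ge> 1"
    using portrait_map_in[OF parent_index[OF assms], of A] by (simp add: m_def)
  moreover have "portrait_map A (Suc j) i = 2 * m - 1 \<or> portrait_map A (Suc j) i = 2 * m"
    using portrait_map_Suc[of A j i] by (simp only: m_def insert_iff empty_iff) blast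
  ultimately have "(portrait_map A (Suc j) i + 1) div 2 = m" by linarith
  then show ?thesis by (simp only: m_def)
qed

lemma portrait_map_even:
  assumes "i \<in> {1..2 ^ Suc j}"
  shows "even (portrait_map A (Suc j) i) \<longleftrightarrow> (odd i \<longleftrightarrow> (j, (i + 1) div 2) \<in> A)"
proof -
  define m where "m = portrait_map A j ((i + 1) div 2)"
  have "m \<ge> 1"
    using portrait_map_in[OF parent_index[OF assms], of A] by (simp add: m_def)
  moreover have "portrait_map A (Suc j) i =
      (if odd i \<longleftrightarrow> (j, (i + 1) div 2) \<in> A then 2 * m else 2 * m - 1)"
    by (simp only: portrait_map.simps Let_def m_def)
  moreover have "even (if P then 2 * m else 2 * m - 1) \<longleftrightarrow> P" if "m \<ge> 1" for P
    using that by simp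
  ultimately show ?thesis by metis
qed

lemma portrait_map_inj: "inj_on (portrait_map A j) {1..2 ^ j}"
proof (induction j)
  case (Suc j)
  show ?case
  proof (rule inj_onI)
    fix x y assume x: "x \<in> {1..2 ^ Suc j}" and y: "y \<in> {1..2 ^ Suc j}"
      and eq: "portrait_map A (Suc j) x = portrait_map A (Suc j) y"
    have px: "(x + 1) div 2 \<in> {1..2 ^ j}" and py: "(y + 1) div 2 \<in> {1..2 ^ j}"
      using x y by auto
    have pxy: "(x + 1) div 2 = (y + 1) div 2"
      using portrait_map_parent[OF x, of A] portrait_map_parent[OF y, of A] eq Suc px py
      by (metis inj_onD)
    have "odd x \<longleftrightarrow> odd y"
      using portrait_map_even[OF x, of A] portrait_map_even[OF y, of A] eq pxy by metis
    with pxy show "x = y" by presburger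
  qed
qed simp

lemma ex1_aut_with_portrait:
  assumes A: "A \<subseteq> {(j, i). j < k \<and> i \<in> {1..2 ^ j}}"
  shows "\<exists>!g. g \<in> tree_auts k \<and> active_vertices k g = A"
proof (rule ex_ex1I)
  define g where "g = (\<lambda>v. if v \<in> tree_vertices k then (fst v, portrait_map A (fst v) (snd v)) else v)"
  have inV: "g v \<in> tree_vertices k" if "v \<in> tree_vertices k" for v
    using that portrait_map_in[of "snd v" "fst v" A] by (auto simp: g_def tree_vertices_def)
  have "inj_on g (tree_vertices k)"
  proof (rule inj_onI)
    fix u v assume u: "u \<in> tree_vertices k" and v: "v \<in> tree_vertices k" and "g u = g v"
    then have "fst u = fst v" "portrait_map A (fst u) (snd u) = portrait_map A (fst v) (snd v)"
      by (auto simp: g_def)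
    then show "u = v"
      using portrait_map_inj[of A "fst u"] u v
      by (auto simp: tree_vertices_def inj_on_def prod_eq_iff)
  qed
  moreover from this have "g ` tree_vertices k = tree_vertices k"
    using inV by (intro endo_inj_surj finite_tree_vertices) auto
  ultimately have "g permutes tree_vertices k"
    by (intro bij_imp_permutes) (auto simp: bij_betw_def g_def)
  moreover have "g tree_root = tree_root"
    by (simp add: g_def tree_root_def)
  moreover have child: "child_of (g u) (g v) \<longleftrightarrow> child_of u v"
    if u: "u \<in> tree_vertices k" and v: "v \<in> tree_vertices k" for u v
  proof -
    obtain j i j' i' where uv: "u = (j', i')" "v = (j, i)" by (metis surj_pair)
    have i: "i \<in> {1..2 ^ j}" and i': "i' \<in> {1..2 ^ j'}"
      using u v uv by (auto simp: tree_vertices_def)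
    have "child_of (g u) (g v) \<longleftrightarrow> j' = Suc j \<and> portrait_map A j i = (portrait_map A j' i' + 1) div 2"
      using portrait_map_in[OF i, of A] u v by (simp add: uv g_def child_of_iff)
    also have "\<dots> \<longleftrightarrow> j' = Suc j \<and> i = (i' + 1) div 2"
    proof (cases "j' = Suc j")
      case True
      have "(i' + 1) div 2 \<in> {1..2 ^ j}" using i' True by auto
      then show ?thesis
        using portrait_map_parent[of i' j A] i' i True inj_on_eq_iff[OF portrait_map_inj[of A j]]
        by simp
    qed simp
    also have "\<dots> \<longleftrightarrow> child_of u v" using i by (simp add: uv child_of_iff)
    finally show ?thesis .
  qed
  ultimately have aut: "g \<in> tree_auts k"
    by (simp add: tree_auts_def tree_adj_def)
  have "(j, i) \<in> active_vertices k g \<longleftrightarrow> (j, i) \<in> A" if "j < k" "i \<in> {1..2 ^ j}" for j i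
  proof -
    have V: "(j, i) \<in> tree_vertices k" "(Suc j, 2 * i - 1) \<in> tree_vertices k"
      using that by (auto simp: tree_vertices_def)
    have p: "(2 * i - 1 + 1) div 2 = i" "odd (2 * i - 1)" using that by auto
    have "g (Suc j, 2 * i - 1) =
        (Suc j, if (j, i) \<in> A then 2 * portrait_map A j i else 2 * portrait_map A j i - 1)"
      using V p by (simp add: g_def Let_def del: even_diff_nat)
    then show ?thesis
      using V that portrait_map_in[OF that(2), of A] by (auto simp: active_vertices_def g_def)
  qed
  then have "active_vertices k g = A"
    using A by (auto simp: active_vertices_def)
  with aut show "\<exists>g. g \<in> tree_auts k \<and> active_vertices k g = A" by blast
next
  fix g h
  assume "g \<in> tree_auts k \<and> active_vertices k g = A" "h \<in> tree_auts k \<and> active_vertices k h = A"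
  then show "g = h" using portrait_unique by blast
qed

lemma aut_with_portrait:
  assumes "A \<subseteq> {(j, i). j < k \<and> i \<in> {1..2 ^ j}}"
  shows "aut_with_portrait k A \<in> tree_auts k" "active_vertices k (aut_with_portrait k A) = A"
  using theI'[OF ex1_aut_with_portrait[OF assms]] by (auto simp: aut_with_portrait_def)

lemma S_alpha_subset: "k \<ge> 2 \<Longrightarrow> S_alpha k \<subseteq> carrier (tree_aut_group k)"
proof -
  assume "k \<ge> 2"
  then have "alpha k l \<in> tree_auts k" if "l \<le> k - 2" for l
    unfolding alpha_def using that by (intro aut_with_portrait) auto
  moreover have "tau k \<in> tree_auts k"
    unfolding tau_def using \<open>k \<ge> 2\<close> by (intro aut_with_portrait) auto
  ultimately show ?thesis by (auto simp: S_alpha_def tree_aut_group_def)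
qed

lemma group_tree_aut_group: "group (tree_aut_group k)"
proof (rule groupI)
  fix f g assume "f \<in> carrier (tree_aut_group k)" "g \<in> carrier (tree_aut_group k)"
  then show "f \<otimes>\<^bsub>tree_aut_group k\<^esub> g \<in> carrier (tree_aut_group k)"
    using permutes_compose[of g "tree_vertices k" f]
    by (simp add: tree_aut_group_def tree_auts_def permutes_in_image)
next
  fix g assume "g \<in> carrier (tree_aut_group k)"
  then have g: "g permutes tree_vertices k" "g tree_root = tree_root"
    "\<And>u v. u \<in> tree_vertices k \<Longrightarrow> v \<in> tree_vertices k \<Longrightarrow> tree_adj (g u) (g v) \<longleftrightarrow> tree_adj u v"
    by (auto simp: tree_aut_group_def tree_auts_def)
  let ?h = "Hilbert_Choice.inv g"
  have h: "?h permutes tree_vertices k" using g(1) by (rule permutes_inv)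
  have "?h tree_root = tree_root" using g(1,2) by (metis permutes_inverses(2))
  moreover have "tree_adj (?h u) (?h v) \<longleftrightarrow> tree_adj u v"
    if "u \<in> tree_vertices k" "v \<in> tree_vertices k" for u v
    using g(3)[of "?h u" "?h v"] that permutes_in_image[OF h] permutes_inverses(1)[OF g(1)] by simp
  ultimately have "?h \<in> carrier (tree_aut_group k)"
    using h by (simp add: tree_aut_group_def tree_auts_def)
  moreover have "?h \<otimes>\<^bsub>tree_aut_group k\<^esub> g = \<one>\<^bsub>tree_aut_group k\<^esub>"
    using permutes_inv_o(2)[OF g(1)] by (simp add: tree_aut_group_def)
  ultimately show "\<exists>h\<in>carrier (tree_aut_group k). h \<otimes>\<^bsub>tree_aut_group k\<^esub> g = \<one>\<^bsub>tree_aut_group k\<^esub>"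
    by blast
qed (auto simp: tree_aut_group_def tree_auts_def permutes_id comp_assoc)

end

theory Submission
  imports Defs
begin

text \<open>The state of \<open>g \<circ> h\<close> at \<open>v\<close> is the sum modulo 2 of the state of \<open>h\<close> at \<open>v\<close> and that of \<open>g\<close>
  at \<open>h v\<close>. Conjugating \<open>\<alpha>\<^sub>l\<close> by automorphisms supported above level \<open>l\<close> moves its active
  vertex to any place on the level, so by induction the group contains all portraits supported on
  the levels below \<open>k - 1\<close>. Conjugating \<open>\<tau>\<close> by these, one obtains the automorphisms whose active
  vertices are \<open>v\<^sub>k\<^sub>-\<^sub>1\<^sub>,\<^sub>1\<close> and any other vertex of level \<open>k - 1\<close>. Hence every portrait occurs up to
  its state at \<open>v\<^sub>k\<^sub>-\<^sub>1\<^sub>,\<^sub>1\<close>, and the group has order at least \<open>2 ^ (2 ^ k - 2)\<close>, the exact power of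
  2 dividing the order of the alternating group. Conversely, the group is a 2-group because it lies
  in the automorphism group of the tree, which has \<open>2 ^ (2 ^ k - 1)\<close> elements, and it acts
  faithfully on the leaves by even permutations because its generators do.\<close>

section \<open>Automorphisms in terms of portraits\<close>

text \<open>The vertices that carry a state; the portraits are exactly the subsets of this
  set.\<close>

definition internal_vertices :: "nat \<Rightarrow> vertex set" where
  "internal_vertices k = {(j, i). j < k \<and> i \<in> {1..2 ^ j}}"

text \<open>Evaluates a portrait by the recursion of \<open>portrait_map\<close>, so that a set
  \<open>A\<close> moves vertices without the definite description behind
  \<open>aut_with_portrait\<close>.\<close>

definition portrait_act :: "vertex set \<Rightarrow> vertex \<Rightarrow> vertex" where
  "portrait_act A v = (fst v, portrait_map A (fst v) (snd v))"

lemma portrait_act_Pair: "portrait_act A (j, i) = (j, portrait_map A j i)"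
  by (simp add: portrait_act_def)

lemma fst_portrait_act [simp]: "fst (portrait_act A v) = fst v"
  by (simp add: portrait_act_def)

lemma portrait_act_inj:
  assumes "u \<in> internal_vertices k" "v \<in> internal_vertices k" "portrait_act A u = portrait_act A v"
  shows "u = v"
proof -
  have "fst u = fst v" "portrait_map A (fst u) (snd u) = portrait_map A (fst v) (snd v)"
    using assms(3) by (auto simp: portrait_act_def)
  then show ?thesis
    using assms(1,2) inj_onD[OF portrait_map_inj[of A "fst v"], of "snd u" "snd v"]
    by (auto simp: internal_vertices_def prod_eq_iff)
qed

lemma portrait_act_in: "v \<in> internal_vertices k \<Longrightarrow> portrait_act A v \<in> internal_vertices k"
  using portrait_map_in[of "snd v" "fst v" A] by (auto simp: internal_vertices_def portrait_act_def)

lemma active_subset: "active_vertices k g \<subseteq> internal_vertices k"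
  by (auto simp: active_vertices_def internal_vertices_def)

lemma internal_in_tree: "v \<in> internal_vertices k \<Longrightarrow> v \<in> tree_vertices k"
  by (auto simp: internal_vertices_def tree_vertices_def)

lemma finite_internal: "finite (internal_vertices k)"
  by (rule finite_subset[OF _ finite_tree_vertices[of k]]) (auto intro: internal_in_tree)

lemma card_internal: "card (internal_vertices k) = 2 ^ k - 1"
proof (induction k)
  case (Suc k)
  have eq: "internal_vertices (Suc k) = internal_vertices k \<union> Pair k ` {1..2 ^ k}"
    by (auto simp: internal_vertices_def less_Suc_eq)
  have "card (internal_vertices (Suc k)) = card (internal_vertices k) + card (Pair k ` {1..2 ^ k :: nat})"
    unfolding eq using finite_internal
    by (intro card_Un_disjoint) (auto simp: internal_vertices_def)
  also have "card (Pair k ` {1..2 ^ k :: nat}) = 2 ^ k"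
    by (subst card_image) (auto simp: inj_on_def)
  finally show ?case using Suc by simp
qed (simp add: internal_vertices_def)

lemma aut_with_portrait_internal:
  assumes "A \<subseteq> internal_vertices k"
  shows "aut_with_portrait k A \<in> tree_auts k" "active_vertices k (aut_with_portrait k A) = A"
  using aut_with_portrait[of A k] assms by (auto simp: internal_vertices_def)

text \<open>Links abstract automorphisms with the explicit recursion. Once the image of a parent is
  known, its children go to the children of that image; the state tells where the left child goes,
  and injectivity settles the right one.\<close>

lemma tree_aut_eq_portrait_map:
  assumes g: "g \<in> tree_auts k" and "(j, i) \<in> tree_vertices k"
  shows "g (j, i) = (j, portrait_map (active_vertices k g) j i)"
  using assms(2)
proof (induction j arbitrary: i)
  case 0
  then have "i = 1" by (auto simp: tree_vertices_def)
  then show ?case using g by (auto simp: tree_auts_def tree_root_def)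
next
  case (Suc j)
  define p where "p = (i + 1) div 2"
  define m where "m = portrait_map (active_vertices k g) j p"
  have p: "(j, p) \<in> tree_vertices k" and p1: "1 \<le> p" "p \<le> 2 ^ j" and jk: "j < k"
    using parent_in_tree[OF Suc.prems] Suc.prems by (auto simp: p_def tree_vertices_def)
  have gp: "g (j, p) = (j, m)" using Suc.IH[OF p] by (simp add: m_def)
  have odd_in: "(Suc j, 2 * p - 1) \<in> tree_vertices k" and even_in: "(Suc j, 2 * p) \<in> tree_vertices k"
    using p1 jk by (auto simp: tree_vertices_def)
  have parents: "(2 * p - 1 + 1) div 2 = p" "(2 * p + 1) div 2 = p" using p1 by auto
  have c1: "child_of (g (Suc j, 2 * p - 1)) (j, m)"
    using tree_aut_child[OF g odd_in] gp unfolding parents by simp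
  have c2: "child_of (g (Suc j, 2 * p)) (j, m)"
    using tree_aut_child[OF g even_in] gp unfolding parents by simp
  have inj: "inj g" using g by (auto simp: tree_auts_def dest: permutes_inj)
  have ne: "g (Suc j, 2 * p - 1) \<noteq> g (Suc j, 2 * p)"
    using inj_eq[OF inj] p1 by auto
  have act: "(j, p) \<in> active_vertices k g \<longleftrightarrow> g (Suc j, 2 * p - 1) = (Suc j, 2 * m)"
    using jk p1 gp by (auto simp: active_vertices_def)
  have odd_val: "g (Suc j, 2 * p - 1) = (Suc j, if (j, p) \<in> active_vertices k g then 2 * m else 2 * m - 1)"
    using c1 act by (auto simp: child_of_def prod_eq_iff)
  have even_val: "g (Suc j, 2 * p) = (Suc j, if (j, p) \<in> active_vertices k g then 2 * m - 1 else 2 * m)"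
    using c2 ne odd_val by (auto simp: child_of_def prod_eq_iff split: if_splits)
  have val: "portrait_map (active_vertices k g) (Suc j) i =
      (if odd i \<longleftrightarrow> (j, p) \<in> active_vertices k g then 2 * m else 2 * m - 1)"
    by (simp only: portrait_map.simps Let_def m_def p_def)
  show ?case
  proof (cases "odd i")
    case True
    then have "i = 2 * p - 1" unfolding p_def by presburger
    with True odd_val val show ?thesis by simp
  next
    case False
    then have "i = 2 * p" unfolding p_def by presburger
    with False even_val val show ?thesis by simp
  qed
qed

lemma tree_auts_comp: "g \<in> tree_auts k \<Longrightarrow> h \<in> tree_auts k \<Longrightarrow> g \<circ> h \<in> tree_auts k"
  using monoid.m_closed[OF group.is_monoid[OF group_tree_aut_group[of k]], of g h]
  by (simp add: tree_aut_group_def)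

lemma active_comp:
  assumes g: "g \<in> tree_auts k" and h: "h \<in> tree_auts k"
  shows "active_vertices k (g \<circ> h) =
    {v \<in> internal_vertices k. (v \<in> active_vertices k h) \<noteq>
       (portrait_act (active_vertices k h) v \<in> active_vertices k g)}"
    (is "?C = ?R")
proof -
  let ?A = "active_vertices k g" and ?B = "active_vertices k h"
  have comp: "portrait_map ?C j i = portrait_map ?A j (portrait_map ?B j i)"
    if "(j, i) \<in> tree_vertices k" for j i
  proof -
    have "(j, portrait_map ?B j i) \<in> tree_vertices k"
      using that portrait_map_in[of i j ?B] by (simp add: tree_vertices_def)
    then show ?thesis
      using tree_aut_eq_portrait_map[OF h that] tree_aut_eq_portrait_map[OF g]
        tree_aut_eq_portrait_map[OF tree_auts_comp[OF g h] that] by simp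
  qed
  have "(j, p) \<in> ?C \<longleftrightarrow> ((j, p) \<in> ?B) \<noteq> (portrait_act ?B (j, p) \<in> ?A)"
    if v: "(j, p) \<in> internal_vertices k" for j p
  proof -
    \<comment> \<open>The left child of \<open>(j, p)\<close>. By \<open>portrait_map_even\<close>
      the parity of its image shows the state at \<open>(j, p)\<close>, and parity changes add up
      under composition.\<close>
    define i where "i = 2 * p - 1"
    have p: "p \<in> {1..2 ^ j}" and jk: "j < k" using v by (auto simp: internal_vertices_def)
    then have i: "i \<in> {1..2 ^ Suc j}" and par: "(i + 1) div 2 = p" and odd: "odd i"
      by (auto simp: i_def)
    have iV: "(Suc j, i) \<in> tree_vertices k" using i jk by (auto simp: tree_vertices_def)
    have Bi: "portrait_map ?B (Suc j) i \<in> {1..2 ^ Suc j}" by (rule portrait_map_in[OF i])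
    show ?thesis
      using portrait_map_even[OF i, of ?C] portrait_map_even[OF i, of ?B]
        portrait_map_even[OF Bi, of ?A] portrait_map_parent[OF i, of ?B] comp[OF iV] par odd
      by (metis portrait_act_Pair)
  qed
  then show ?thesis using active_subset[of k "g \<circ> h"] by auto
qed

section \<open>Images of vertices under portrait maps\<close>

lemma portrait_map_cong:
  assumes "\<And>j p. j < n \<Longrightarrow> (j, p) \<in> A \<longleftrightarrow> (j, p) \<in> B"
  shows "portrait_map A n i = portrait_map B n i"
  using assms
proof (induction n arbitrary: i)
  case (Suc n)
  have "portrait_map A n p = portrait_map B n p" for p
    using Suc.prems by (intro Suc.IH) simp
  then show ?case using Suc.prems[of n] by (simp add: Let_def)
qed simp

lemma portrait_map_empty: "i \<in> {1..2 ^ n} \<Longrightarrow> portrait_map {} n i = i"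
proof (induction n arbitrary: i)
  case (Suc n)
  have "(portrait_map {} (Suc n) i + 1) div 2 = (i + 1) div 2"
    using Suc.IH[OF parent_index[OF Suc.prems]] portrait_map_parent[OF Suc.prems, of "{}"] by simp
  moreover have "even (portrait_map {} (Suc n) i) \<longleftrightarrow> even i"
    using portrait_map_even[OF Suc.prems, of "{}"] by simp
  ultimately show ?case by presburger
qed simp

lemma portrait_map_id:
  assumes "\<And>j p. (j, p) \<in> A \<Longrightarrow> n \<le> j" "i \<in> {1..2 ^ n}"
  shows "portrait_map A n i = i"
proof -
  have "portrait_map A n i = portrait_map {} n i"
    by (rule portrait_map_cong) (use assms(1) in force)
  then show ?thesis using portrait_map_empty[OF assms(2)] by simp
qed

text \<open>The image of a vertex depends only on the states at its proper ancestors, which all lie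
  on smaller levels.\<close>

lemma portrait_act_id:
  assumes "\<And>u. u \<in> A \<Longrightarrow> fst v \<le> fst u" "v \<in> internal_vertices k"
  shows "portrait_act A v = v"
proof -
  have "portrait_map A (fst v) (snd v) = snd v"
    using assms by (intro portrait_map_id) (force simp: internal_vertices_def)+
  then show ?thesis by (simp add: portrait_act_def)
qed

text \<open>The half of a level is inherited from the ancestor on level 1, so only the state at the
  root can exchange the halves.\<close>

lemma portrait_map_half:
  "i \<in> {1..2 ^ Suc n} \<Longrightarrow>
    2 ^ n < portrait_map A (Suc n) i \<longleftrightarrow> (2 ^ n < i) \<noteq> ((0, 1) \<in> A)"
proof (induction n arbitrary: i)
  case 0
  then have "i = 1 \<or> i = 2" by auto
  then show ?case by auto
next
  case (Suc n)
  have half: "2 ^ Suc n < x \<longleftrightarrow> 2 ^ n < (x + 1) div 2" for x :: nat by auto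
  show ?case
    unfolding half portrait_map_parent[OF Suc.prems] by (rule Suc.IH[OF parent_index[OF Suc.prems]])
qed

text \<open>All proper ancestors of a leftmost vertex are leftmost, so no active state is met on the
  way down.\<close>

lemma portrait_map_leftmost:
  assumes "\<And>j. (j, 1) \<notin> A"
  shows "portrait_map A n 1 = 1"
proof (induction n)
  case (Suc n)
  show ?case using Suc assms[of n] by simp
qed simp

text \<open>Only states along the path from the root to \<open>s\<close> have to be set, each so
  that the image follows the path to \<open>i\<close>. The extra clause later allows the last vertex
  of a level to be moved within the right half while the first one stays fixed.\<close>

lemma portrait_map_transitive:
  assumes "s \<in> {1..2 ^ n}" "i \<in> {1..2 ^ n}"
  shows "\<exists>A \<subseteq> internal_vertices n. portrait_map A n s = i \<and>
    (2 ^ n div 2 < s \<and> 2 ^ n div 2 < i \<longrightarrow> (\<forall>j. (j, 1) \<notin> A))"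
  using assms
proof (induction n arbitrary: s i)
  case 0
  then show ?case by (intro exI[of _ "{}"]) auto
next
  case (Suc n)
  define p where "p = (s + 1) div 2"
  define q where "q = (i + 1) div 2"
  have p: "p \<in> {1..2 ^ n}" and q: "q \<in> {1..2 ^ n}"
    using parent_index[OF Suc.prems(1)] parent_index[OF Suc.prems(2)] by (simp_all add: p_def q_def)
  obtain A where A: "A \<subseteq> internal_vertices n" "portrait_map A n p = q"
    and right: "2 ^ n div 2 < p \<and> 2 ^ n div 2 < q \<Longrightarrow> \<forall>j. (j, 1) \<notin> A"
    using Suc.IH[OF p q] by auto
  \<comment> \<open>The parent \<open>p\<close> of \<open>s\<close> already goes to the parent
    \<open>q\<close> of \<open>i\<close>; it has to be active exactly when \<open>s\<close> and
    \<open>i\<close> are children on different sides.\<close>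
  define B where "B = A \<union> (if odd s = odd i then {} else {(n, p)})"
  have new: "(n, r) \<notin> A" for r using A(1) by (auto simp: internal_vertices_def)
  have "portrait_map B n p = portrait_map A n p"
    by (rule portrait_map_cong) (auto simp: B_def)
  then have par: "(portrait_map B (Suc n) s + 1) div 2 = q"
    using portrait_map_parent[OF Suc.prems(1), of B] A(2) by (simp add: p_def)
  have "even (portrait_map B (Suc n) s) \<longleftrightarrow> (odd s \<longleftrightarrow> (n, p) \<in> B)"
    using portrait_map_even[OF Suc.prems(1), of B] by (simp add: p_def)
  then have "even (portrait_map B (Suc n) s) \<longleftrightarrow> even i"
    using new by (auto simp: B_def)
  with par have val: "portrait_map B (Suc n) s = i" unfolding q_def by presburger
  have "B \<subseteq> internal_vertices (Suc n)"
    using A(1) p by (auto simp: B_def internal_vertices_def)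
  moreover have "\<forall>j. (j, 1) \<notin> B" if "2 ^ Suc n div 2 < s" "2 ^ Suc n div 2 < i"
  proof -
    have big: "2 ^ n < s" "2 ^ n < i" using that by auto
    show ?thesis
    proof (cases n)
      \<comment> \<open>On level 1 the parent of \<open>s\<close> is the root, itself leftmost; it
        stays inactive because \<open>s = i\<close>.\<close>
      case 0
      then have "s = 2" "i = 2" using big Suc.prems by auto
      then show ?thesis using 0 A(1) by (auto simp: B_def internal_vertices_def)
    next
      case (Suc m)
      then have "2 ^ m < p" "2 ^ m < q" using big by (auto simp: p_def q_def)
      moreover have "(1::nat) \<le> 2 ^ m" by simp
      ultimately show ?thesis using right Suc by (auto simp: B_def)
    qed
  qed
  ultimately show ?case using val by blast
qed


section \<open>Portraits of the generated group\<close>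

definition generated_portraits :: "nat \<Rightarrow> vertex set set" where
  "generated_portraits k = active_vertices k ` generate (tree_aut_group k) (S_alpha k)"

lemma generate_subset:
  assumes "k \<ge> 2"
  shows "generate (tree_aut_group k) (S_alpha k) \<subseteq> tree_auts k"
  using group.generate_incl[OF group_tree_aut_group S_alpha_subset[OF assms]]
  by (simp add: tree_aut_group_def)

lemma generated_portraits_subset: "A \<in> generated_portraits k \<Longrightarrow> A \<subseteq> internal_vertices k"
  using active_subset by (auto simp: generated_portraits_def)

lemma generated_portraitsI:
  "g \<in> generate (tree_aut_group k) (S_alpha k) \<Longrightarrow> active_vertices k g = A \<Longrightarrow>
    A \<in> generated_portraits k"
  by (auto simp: generated_portraits_def)

lemma empty_generated: "{} \<in> generated_portraits k"
proof -
  have "active_vertices k id = {}" by (auto simp: active_vertices_def)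
  moreover have "id \<in> generate (tree_aut_group k) (S_alpha k)"
    using generate.one[of "tree_aut_group k" "S_alpha k"] by (simp add: tree_aut_group_def)
  ultimately show ?thesis by (intro generated_portraitsI)
qed

lemma alpha_generated:
  assumes "k \<ge> 2" "l \<le> k - 2"
  shows "{(l, 1)} \<in> generated_portraits k"
proof -
  have "active_vertices k (alpha k l) = {(l, 1)}"
    unfolding alpha_def using assms by (intro aut_with_portrait) auto
  moreover have "alpha k l \<in> generate (tree_aut_group k) (S_alpha k)"
    using assms(2) by (intro generate.incl) (auto simp: S_alpha_def)
  ultimately show ?thesis by (intro generated_portraitsI)
qed

lemma tau_generated:
  assumes "k \<ge> 2"
  shows "{(k - 1, 1), (k - 1, 2 ^ (k - 1))} \<in> generated_portraits k"
proof -
  have "active_vertices k (tau k) = {(k - 1, 1), (k - 1, 2 ^ (k - 1))}"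
    unfolding tau_def using assms by (intro aut_with_portrait) auto
  moreover have "tau k \<in> generate (tree_aut_group k) (S_alpha k)"
    by (intro generate.incl) (auto simp: S_alpha_def)
  ultimately show ?thesis by (intro generated_portraitsI)
qed

text \<open>A portrait \<open>B\<close> starting on level \<open>l\<close> fixes every vertex up to
  that level, and \<open>A\<close> has no active vertex on later levels, so in
  \<open>active_comp\<close> the states simply add. Level \<open>l\<close> itself may be
  shared.\<close>

lemma sym_diff_generated:
  assumes "k \<ge> 2" "A \<in> generated_portraits k" "B \<in> generated_portraits k"
    and A: "\<And>u. u \<in> A \<Longrightarrow> fst u \<le> l" and B: "\<And>u. u \<in> B \<Longrightarrow> l \<le> fst u"
  shows "(A - B) \<union> (B - A) \<in> generated_portraits k"
proof -
  obtain g h where g: "g \<in> generate (tree_aut_group k) (S_alpha k)" "A = active_vertices k g"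
    and h: "h \<in> generate (tree_aut_group k) (S_alpha k)" "B = active_vertices k h"
    using assms(2,3) by (auto simp: generated_portraits_def)
  have gh: "g \<circ> h \<in> generate (tree_aut_group k) (S_alpha k)"
    using generate.eng[OF g(1) h(1)] by (simp add: tree_aut_group_def)
  have "active_vertices k (g \<circ> h) = {v \<in> internal_vertices k. (v \<in> B) \<noteq> (portrait_act B v \<in> A)}"
    using active_comp[of g k h] generate_subset[OF assms(1)] g h by auto
  also have "\<dots> = (A - B) \<union> (B - A)"
  proof -
    have "portrait_act B v \<in> A \<longleftrightarrow> v \<in> A" if v: "v \<in> internal_vertices k" for v
    proof (cases "fst v \<le> l")
      case True
      then have "portrait_act B v = v" using B v by (intro portrait_act_id) force+
      then show ?thesis by simp
    next
      case False
      then show ?thesis using A[of v] A[of "portrait_act B v"] by auto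
    qed
    then show ?thesis
      using generated_portraits_subset[OF assms(2)] generated_portraits_subset[OF assms(3)] by blast
  qed
  finally show ?thesis using gh by (intro generated_portraitsI)
qed

text \<open>Conjugation by an element with portrait \<open>H\<close> carries the active vertices in
  \<open>X\<close> along. The level conditions ensure that \<open>X\<close> fixes all vertices at
  which \<open>H\<close> may be active.\<close>

lemma conjugate_generated:
  assumes k: "k \<ge> 2" and "H \<in> generated_portraits k" "X \<in> generated_portraits k"
    and H: "\<And>u. u \<in> H \<Longrightarrow> fst u < l" and X: "\<And>u. u \<in> X \<Longrightarrow> fst u = l"
  shows "portrait_act H ` X \<in> generated_portraits k"
proof -
  obtain h x where h: "h \<in> generate (tree_aut_group k) (S_alpha k)" "H = active_vertices k h"
    and x: "x \<in> generate (tree_aut_group k) (S_alpha k)" "X = active_vertices k x"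
    using assms(2,3) by (auto simp: generated_portraits_def)
  have hx: "h \<in> tree_auts k" "x \<in> tree_auts k" using generate_subset[OF k] h x by auto
  have Xin: "X \<subseteq> internal_vertices k" by (rule generated_portraits_subset[OF assms(3)])
  \<comment> \<open>The candidate for the conjugate is built from its portrait, and
    \<open>y \<circ> h = h \<circ> x\<close> is checked on portraits; this avoids computing the
    portrait of an inverse.\<close>
  define y where "y = aut_with_portrait k (portrait_act H ` X)"
  have "portrait_act H ` X \<subseteq> internal_vertices k"
    using portrait_act_in Xin by blast
  then have y: "y \<in> tree_auts k" "active_vertices k y = portrait_act H ` X"
    unfolding y_def by (rule aut_with_portrait_internal)+
  have "active_vertices k (y \<circ> h) = active_vertices k (h \<circ> x)"
  proof -
    have "(v \<in> H) \<noteq> (portrait_act H v \<in> portrait_act H ` X) \<longleftrightarrow> (v \<in> X) \<noteq> (portrait_act X v \<in> H)"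
      if v: "v \<in> internal_vertices k" for v
    proof -
      have "portrait_act H v \<in> portrait_act H ` X \<longleftrightarrow> v \<in> X"
        using portrait_act_inj[OF v] Xin by blast
      moreover have "portrait_act X v \<in> H \<longleftrightarrow> v \<in> H"
      proof (cases "fst v < l")
        case True
        then have "portrait_act X v = v" using X v by (intro portrait_act_id) force+
        then show ?thesis by simp
      next
        case False
        then show ?thesis using H[of v] H[of "portrait_act X v"] by auto
      qed
      ultimately show ?thesis by blast
    qed
    then show ?thesis
      using active_comp[OF y(1) hx(1)] active_comp[OF hx] h(2) x(2) y(2) by auto
  qed
  then have yh: "y \<circ> h = h \<circ> x"
    by (rule portrait_unique[OF tree_auts_comp[OF y(1) hx(1)] tree_auts_comp[OF hx]])
  interpret T: group "tree_aut_group k" by (rule group_tree_aut_group)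
  have carr: "y \<in> carrier (tree_aut_group k)" "h \<in> carrier (tree_aut_group k)"
    "x \<in> carrier (tree_aut_group k)"
    using y hx by (auto simp: tree_aut_group_def)
  have "y = (h \<otimes>\<^bsub>tree_aut_group k\<^esub> x) \<otimes>\<^bsub>tree_aut_group k\<^esub> inv\<^bsub>tree_aut_group k\<^esub> h"
    using carr yh tree_auts_comp[OF hx] by (subst T.inv_solve_right) (auto simp: tree_aut_group_def)
  moreover have "inv\<^bsub>tree_aut_group k\<^esub> h \<in> generate (tree_aut_group k) (S_alpha k)"
    by (rule T.generate_m_inv_closed[OF S_alpha_subset[OF k] h(1)])
  ultimately have "y \<in> generate (tree_aut_group k) (S_alpha k)"
    using generate.eng h(1) x(1) by metis
  then show ?thesis using y(2) by (rule generated_portraitsI)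
qed

lemma lower_portraits_generated:
  assumes k: "k \<ge> 2" and "l \<le> k - 1" "A \<subseteq> internal_vertices l"
  shows "A \<in> generated_portraits k"
  using assms(2,3)
proof (induction l arbitrary: A)
  case 0
  then show ?case using empty_generated by (simp add: internal_vertices_def)
next
  case (Suc l)
  have single: "{(l, i)} \<in> generated_portraits k" if i: "i \<in> {1..2 ^ l}" for i
  proof -
    obtain H where H: "H \<subseteq> internal_vertices l" "portrait_map H l 1 = i"
      using portrait_map_transitive[of 1 l i] i by auto
    have "H \<in> generated_portraits k" using Suc.IH H(1) Suc.prems(1) by simp
    moreover have "{(l, 1)} \<in> generated_portraits k"
      \<comment> \<open>Here \<open>l\<close> is at most \<open>k - 2\<close>, the last level with a
        generator \<open>alpha k l\<close>.\<close>
      using Suc.prems(1) k by (intro alpha_generated) auto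
    ultimately have "portrait_act H ` {(l, 1)} \<in> generated_portraits k"
      using H(1) by (intro conjugate_generated[OF k, where l = l]) (auto simp: internal_vertices_def)
    then show ?thesis using H(2) by (simp add: portrait_act_Pair)
  qed
  have level: "C \<in> generated_portraits k" if "finite C" "C \<subseteq> {l} \<times> {1..2 ^ l}" for C
    using that
  proof (induction C rule: finite_induct)
    case empty
    show ?case by (rule empty_generated)
  next
    case (insert v C)
    have "{v} \<in> generated_portraits k" using insert.prems single by auto
    then have "({v} - C) \<union> (C - {v}) \<in> generated_portraits k"
      using insert by (intro sym_diff_generated[OF k, where l = l]) auto
    moreover have "({v} - C) \<union> (C - {v}) = insert v C" using insert.hyps by auto
    ultimately show ?case by simp
  qed
  define B where "B = A \<inter> internal_vertices l"
  define C where "C = A \<inter> {l} \<times> {1..2 ^ l}"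
  have "B \<in> generated_portraits k" using Suc by (auto simp: B_def)
  moreover have "C \<in> generated_portraits k"
    by (rule level) (auto simp: C_def)
  ultimately have "(B - C) \<union> (C - B) \<in> generated_portraits k"
    by (intro sym_diff_generated[OF k, where l = l]) (auto simp: B_def C_def internal_vertices_def)
  moreover have "(B - C) \<union> (C - B) = A"
    using Suc.prems(2) by (auto simp: B_def C_def internal_vertices_def less_Suc_eq)
  ultimately show ?case by simp
qed

text \<open>A vertex in the right half is reached from the last vertex while \<open>(n, 1)\<close>
  is fixed; a vertex in the left half needs a detour through a vertex \<open>(n, c)\<close> in the
  right half, which cancels in a product.\<close>

lemma pairs_generated:
  assumes n: "n \<ge> 1" and i: "i \<in> {1..2 ^ n}" "i \<noteq> 1"
  shows "{(n, 1), (n, i)} \<in> generated_portraits (Suc n)"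
proof -
  have k: "Suc n \<ge> 2" using n by simp
  obtain m where m: "n = Suc m" using n by (cases n) auto
  have pow: "(1::nat) \<le> 2 ^ m" "(2::nat) ^ n div 2 = 2 ^ m" "(2::nat) ^ m < 2 ^ n"
    using m by auto
  have tau: "{(n, 1), (n, 2 ^ n)} \<in> generated_portraits (Suc n)"
    using tau_generated[OF k] by simp
  have conj: "{(n, portrait_map H n 1), (n, portrait_map H n (2 ^ n))} \<in> generated_portraits (Suc n)"
    if H: "H \<subseteq> internal_vertices n" for H
  proof -
    have "portrait_act H ` {(n, 1), (n, 2 ^ n)} \<in> generated_portraits (Suc n)"
      using H lower_portraits_generated[OF k _ H]
      by (intro conjugate_generated[OF k _ tau, where l = n]) (auto simp: internal_vertices_def)
    then show ?thesis by (simp add: portrait_act_Pair)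
  qed
  have right: "{(n, 1), (n, c)} \<in> generated_portraits (Suc n)"
    if c: "c \<in> {1..2 ^ n}" "2 ^ m < c" for c
  proof -
    obtain H where H: "H \<subseteq> internal_vertices n" "portrait_map H n (2 ^ n) = c" "\<forall>j. (j, 1) \<notin> H"
      using portrait_map_transitive[of "2 ^ n" n c] c pow by auto
    have "portrait_map H n 1 = 1" using H(3) by (intro portrait_map_leftmost) simp
    then show ?thesis using conj[OF H(1)] H(2) by simp
  qed
  show ?thesis
  proof (cases "2 ^ m < i")
    case True
    then show ?thesis using right i by simp
  next
    case False
    obtain H where H: "H \<subseteq> internal_vertices n" "portrait_map H n 1 = i"
      using portrait_map_transitive[of 1 n i] i by auto
    define c where "c = portrait_map H n (2 ^ n)"
    have c: "c \<in> {1..2 ^ n}" unfolding c_def by (rule portrait_map_in) simp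
    \<comment> \<open>Both 1 and its image \<open>i\<close> lie in the left half, so the root is
      inactive and the last vertex stays in the right half.\<close>
    have "(0, 1) \<notin> H"
      using portrait_map_half[of 1 m H] H(2) False m pow by auto
    then have cm: "2 ^ m < c"
      using portrait_map_half[of "2 ^ n" m H] m pow by (auto simp: c_def simp del: portrait_map.simps)
    have ic: "{(n, i), (n, c)} \<in> generated_portraits (Suc n)"
      using conj[OF H(1)] H(2) by (simp add: c_def)
    have "({(n, i), (n, c)} - {(n, 1), (n, c)}) \<union> ({(n, 1), (n, c)} - {(n, i), (n, c)})
        \<in> generated_portraits (Suc n)"
      by (rule sym_diff_generated[OF k ic right[OF c cm], where l = n]) auto
    moreover have "({(n, i), (n, c)} - {(n, 1), (n, c)}) \<union> ({(n, 1), (n, c)} - {(n, i), (n, c)})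
        = {(n, 1), (n, i)}"
      using i False cm pow by auto
    ultimately show ?thesis by simp
  qed
qed

text \<open>Every other vertex of level \<open>n\<close> can be toggled at the price of toggling
  \<open>(n, 1)\<close> too, whose state is therefore left open.\<close>

lemma portraits_generated_up_to_one_vertex:
  assumes n: "n \<ge> 1" and A: "A \<subseteq> internal_vertices (Suc n)"
  shows "\<exists>B \<in> generated_portraits (Suc n). B - {(n, 1)} = A - {(n, 1)}"
proof -
  have k: "Suc n \<ge> 2" using n by simp
  \<comment> \<open>That \<open>B\<close> stays on level \<open>n\<close> is carried through the
    induction because \<open>sym_diff_generated\<close> asks for it.\<close>
  have level: "\<exists>B \<in> generated_portraits (Suc n). (\<forall>u\<in>B. fst u = n) \<and> B - {(n, 1)} = C - {(n, 1)}"
    if "finite C" "C \<subseteq> {n} \<times> {1..2 ^ n}" for C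
    using that
  proof (induction C rule: finite_induct)
    case empty
    show ?case using empty_generated by force
  next
    case (insert v C)
    obtain B where B: "B \<in> generated_portraits (Suc n)" "\<forall>u\<in>B. fst u = n" "B - {(n, 1)} = C - {(n, 1)}"
      using insert by auto
    show ?case
    proof (cases "v = (n, 1)")
      case True
      then show ?thesis using B by auto
    next
      case False
      obtain i where v: "v = (n, i)" "i \<in> {1..2 ^ n}" using insert.prems by auto
      with False have i: "v = (n, i)" "i \<in> {1..2 ^ n}" "i \<noteq> 1" by auto
      let ?D = "{(n, 1), v}"
      have D: "?D \<in> generated_portraits (Suc n)" using pairs_generated[OF n i(2,3)] i(1) by simp
      have "(?D - B) \<union> (B - ?D) \<in> generated_portraits (Suc n)"
        by (rule sym_diff_generated[OF k D B(1), where l = n]) (use B(2) i(1) in auto)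
      moreover have "\<forall>u\<in>(?D - B) \<union> (B - ?D). fst u = n" using B(2) i(1) by auto
      moreover have "(?D - B) \<union> (B - ?D) - {(n, 1)} = insert v C - {(n, 1)}"
        using B(3) insert.hyps False by blast
      ultimately show ?thesis by blast
    qed
  qed
  define A0 where "A0 = A \<inter> internal_vertices n"
  obtain B where B: "B \<in> generated_portraits (Suc n)" "\<forall>u\<in>B. fst u = n"
    "B - {(n, 1)} = (A \<inter> {n} \<times> {1..2 ^ n}) - {(n, 1)}"
    using level[of "A \<inter> {n} \<times> {1..2 ^ n}"] by auto
  have A0: "A0 \<in> generated_portraits (Suc n)"
    using k by (intro lower_portraits_generated[where l = n]) (auto simp: A0_def)
  have "(A0 - B) \<union> (B - A0) \<in> generated_portraits (Suc n)"
    by (rule sym_diff_generated[OF k A0 B(1), where l = n])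
      (use B(2) in \<open>auto simp: A0_def internal_vertices_def\<close>)
  moreover have "A0 \<inter> B = {}" using B(2) by (auto simp: A0_def internal_vertices_def)
  moreover have "A = A0 \<union> (A \<inter> {n} \<times> {1..2 ^ n})"
    using A by (auto simp: A0_def internal_vertices_def less_Suc_eq)
  ultimately show ?thesis using B(3) by (intro bexI[of _ "(A0 - B) \<union> (B - A0)"]) blast+
qed

section \<open>Cardinalities of the two groups of tree automorphisms\<close>

lemma finite_tree_auts: "finite (tree_auts k)"
  by (rule finite_subset[OF _ finite_permutations[OF finite_tree_vertices[of k]]])
    (auto simp: tree_auts_def)

text \<open>Portraits identify automorphisms with sets of internal vertices. That the order is a
  power of 2 later forces the same for the generated group.\<close>

lemma card_tree_auts: "card (tree_auts k) = 2 ^ (2 ^ k - 1)"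
proof -
  have "bij_betw (active_vertices k) (tree_auts k) (Pow (internal_vertices k))"
  proof (rule bij_betwI')
    fix A assume "A \<in> Pow (internal_vertices k)"
    then show "\<exists>g\<in>tree_auts k. A = active_vertices k g"
      using aut_with_portrait_internal[of A k] by blast
  qed (use portrait_unique active_subset in auto)
  then have "card (tree_auts k) = card (Pow (internal_vertices k))" by (rule bij_betw_same_card)
  then show ?thesis by (simp add: card_Pow finite_internal card_internal)
qed

text \<open>Forgetting the state at \<open>(k - 1, 1)\<close> maps the group onto all subsets of the
  other \<open>2 ^ k - 2\<close> internal vertices.\<close>

lemma card_generate_ge:
  assumes k: "k \<ge> 2"
  shows "2 ^ (2 ^ k - 2) \<le> card (generate (tree_aut_group k) (S_alpha k))"
proof -
  define n where "n = k - 1"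
  have n: "n \<ge> 1" "k = Suc n" using k by (auto simp: n_def)
  let ?v = "(n, 1)" and ?G = "generate (tree_aut_group k) (S_alpha k)"
  have finG: "finite ?G" using generate_subset[OF k] finite_tree_auts by (rule finite_subset)
  have "Pow (internal_vertices k - {?v}) \<subseteq> (\<lambda>g. active_vertices k g - {?v}) ` ?G"
  proof
    fix A assume "A \<in> Pow (internal_vertices k - {?v})"
    then have A: "A \<subseteq> internal_vertices (Suc n)" "?v \<notin> A" using n by auto
    then obtain B where "B \<in> generated_portraits k" "B - {?v} = A - {?v}"
      using portraits_generated_up_to_one_vertex[OF n(1) A(1)] n(2) by auto
    then show "A \<in> (\<lambda>g. active_vertices k g - {?v}) ` ?G"
      using A(2) by (auto simp: generated_portraits_def)
  qed
  then have "card (Pow (internal_vertices k - {?v})) \<le> card ?G"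
    using finG by (meson card_image_le card_mono finite_imageI order_trans)
  moreover have "card (internal_vertices k - {?v}) = 2 ^ k - 2"
  proof -
    have "?v \<in> internal_vertices k" using n(2) by (simp add: internal_vertices_def)
    then show ?thesis by (simp add: card_Diff_singleton card_internal)
  qed
  ultimately show ?thesis using finite_internal by (simp add: card_Pow)
qed


section \<open>The action on the leaves\<close>

text \<open>Leaves are named by their index alone, and all other numbers are fixed, as membership in
  \<open>sym_group\<close> requires.\<close>

definition leaf_perm :: "nat \<Rightarrow> (vertex \<Rightarrow> vertex) \<Rightarrow> nat \<Rightarrow> nat" where
  "leaf_perm k g i = (if i \<in> {1..2 ^ k} then snd (g (k, i)) else i)"

text \<open>The counterpart of \<open>leaf_perm\<close> for portraits, with the level as a parameter
  so that level \<open>Suc n\<close> can be compared with level \<open>n\<close>.\<close>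

definition portrait_perm :: "vertex set \<Rightarrow> nat \<Rightarrow> nat \<Rightarrow> nat" where
  "portrait_perm A n i = (if i \<in> {1..2 ^ n} then portrait_map A n i else i)"

lemma portrait_perm_permutes: "portrait_perm A n permutes {1..2 ^ n}"
proof (rule bij_imp_permutes)
  have "inj_on (portrait_perm A n) {1..2 ^ n}"
    using portrait_map_inj[of A n] by (auto simp: inj_on_def portrait_perm_def)
  moreover have "portrait_perm A n ` {1..2 ^ n} \<subseteq> {1..2 ^ n}"
    using portrait_map_in[of _ n A] by (auto simp: portrait_perm_def)
  ultimately show "bij_betw (portrait_perm A n) {1..2 ^ n} {1..2 ^ n}"
    by (simp add: bij_betw_def endo_inj_surj)
qed (auto simp: portrait_perm_def)

lemma leaf_perm_eq:
  assumes "g \<in> tree_auts k"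
  shows "leaf_perm k g = portrait_perm (active_vertices k g) k"
proof
  fix i
  show "leaf_perm k g i = portrait_perm (active_vertices k g) k i"
    using tree_aut_eq_portrait_map[OF assms, of k i]
    by (auto simp: leaf_perm_def portrait_perm_def tree_vertices_def)
qed

lemma leaf_perm_hom: "group_hom (tree_aut_group k) (sym_group (2 ^ k)) (leaf_perm k)"
proof (intro group_hom.intro group_hom_axioms.intro group_tree_aut_group sym_group_is_group homI)
  fix g assume "g \<in> carrier (tree_aut_group k)"
  then show "leaf_perm k g \<in> carrier (sym_group (2 ^ k))"
    using portrait_perm_permutes by (simp add: leaf_perm_eq sym_group_carrier tree_aut_group_def)
next
  fix g h assume "g \<in> carrier (tree_aut_group k)" "h \<in> carrier (tree_aut_group k)"
  then have h: "h \<in> tree_auts k" by (simp add: tree_aut_group_def)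
  have "leaf_perm k (g \<circ> h) i = leaf_perm k g (leaf_perm k h i)" for i
    using tree_aut_eq_portrait_map[OF h, of k i] portrait_map_in[of i k "active_vertices k h"]
    by (auto simp: leaf_perm_def tree_vertices_def)
  then show "leaf_perm k (g \<otimes>\<^bsub>tree_aut_group k\<^esub> h) =
      leaf_perm k g \<otimes>\<^bsub>sym_group (2 ^ k)\<^esub> leaf_perm k h"
    by (auto simp: tree_aut_group_def sym_group_mult)
qed

text \<open>The image of a vertex is the parent of the image of its child, so agreement on the
  leaves climbs up to the root.\<close>

lemma leaf_perm_inj: "inj_on (leaf_perm k) (tree_auts k)"
proof (rule inj_onI)
  fix g h assume g: "g \<in> tree_auts k" and h: "h \<in> tree_auts k" and eq: "leaf_perm k g = leaf_perm k h"
  let ?A = "active_vertices k g" and ?B = "active_vertices k h"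
  have leaves: "portrait_map ?A k i = portrait_map ?B k i" if "i \<in> {1..2 ^ k}" for i
    using fun_cong[OF eq, of i] that by (simp add: leaf_perm_eq g h portrait_perm_def)
  have step: "portrait_map ?A j i = portrait_map ?B j i" if "j \<le> k" "i \<in> {1..2 ^ j}" for j i
    using that
  proof (induction "k - j" arbitrary: j i)
    case 0
    then show ?case using leaves by simp
  next
    case (Suc d)
    define i' where "i' = 2 * i"
    have i': "i' \<in> {1..2 ^ Suc j}" and par: "(i' + 1) div 2 = i" using Suc.prems by (auto simp: i'_def)
    have "portrait_map ?A (Suc j) i' = portrait_map ?B (Suc j) i'"
      by (rule Suc.hyps(1)) (use Suc.hyps(2) i' in auto)
    then show ?case
      using portrait_map_parent[OF i', of ?A] portrait_map_parent[OF i', of ?B] par by metis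
  qed
  show "g = h"
  proof
    fix v
    have "g v = v" "h v = v" if "v \<notin> tree_vertices k"
      using that g h by (auto simp: tree_auts_def permutes_not_in)
    then show "g v = h v"
      using tree_aut_eq_portrait_map[OF g, of "fst v" "snd v"] tree_aut_eq_portrait_map[OF h, of "fst v" "snd v"]
        step[of "fst v" "snd v"]
      by (cases "v \<in> tree_vertices k") (auto simp: tree_vertices_def)
  qed
qed

text \<open>Moves each sibling pair \<open>{2 * i - 1, 2 * i}\<close> as a block. Every transposition of \<open>p\<close>
  becomes a product of two, so the result is even.\<close>

definition sibling_perm :: "(nat \<Rightarrow> nat) \<Rightarrow> nat \<Rightarrow> nat" where
  "sibling_perm p x = 2 * p ((x + 1) div 2) - x mod 2"

lemma sibling_perm_comp:
  assumes "q permutes {1..n}"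
  shows "sibling_perm (p \<circ> q) = sibling_perm p \<circ> sibling_perm q"
proof
  fix x
  define y where "y = q ((x + 1) div 2)"
  \<comment> \<open>A permutation of \<open>{1..n}\<close> fixes 0 and so sends no positive number
    to 0; hence the natural subtraction \<open>2 * y - 1\<close> is not truncated.\<close>
  have y: "y \<ge> 1" if "odd x"
  proof -
    have "(x + 1) div 2 \<noteq> 0" using that by presburger
    moreover have "q 0 = 0" using assms by (auto intro: permutes_not_in)
    ultimately have "y \<noteq> 0" using permutes_inj[OF assms] unfolding y_def by (metis injD)
    then show ?thesis by simp
  qed
  have "(2 * y - x mod 2 + 1) div 2 = y \<and> (2 * y - x mod 2) mod 2 = x mod 2"
  proof (cases "odd x")
    case True
    then have "x mod 2 = 1" by presburger
    moreover obtain z where "y = Suc z" using y[OF True] by (cases y) auto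
    ultimately show ?thesis by simp
  next
    case False
    then have "x mod 2 = 0" by presburger
    then show ?thesis by simp
  qed
  then show "sibling_perm (p \<circ> q) x = (sibling_perm p \<circ> sibling_perm q) x"
    by (simp add: sibling_perm_def y_def)
qed

text \<open>The conjunct on \<open>permutation\<close> is carried through the induction because
  \<open>evenperm_comp\<close> needs it for both factors.\<close>

lemma sibling_perm_even:
  assumes "p permutes {1..n}"
  shows "evenperm (sibling_perm p) \<and> permutation (sibling_perm p)"
  using assms finite_atLeastAtMost
proof (induction rule: permutes_induct)
  case id
  have "sibling_perm id = id" by (rule ext) (simp add: sibling_perm_def, presburger)
  then show ?case by (metis evenperm_id permutation_id)
next
  case (swap a b p)
  let ?s = "transpose (2 * a - 1) (2 * b - 1)" and ?t = "transpose (2 * a) (2 * b)"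
  have ab: "a \<ge> 1" "b \<ge> 1" using swap by auto
  have "sibling_perm (transpose a b) x = (?s \<circ> ?t) x" for x
  proof (cases "odd x")
    case True
    then obtain y where "x = 2 * y + 1" by (auto elim: oddE)
    then show ?thesis using ab by (auto simp: sibling_perm_def transpose_def; presburger?)
  next
    case False
    then obtain y where "x = 2 * y" by (auto elim: evenE)
    then show ?thesis using ab by (auto simp: sibling_perm_def transpose_def; presburger?)
  qed
  then have st: "sibling_perm (transpose a b) = ?s \<circ> ?t" by blast
  have "2 * a - 1 \<noteq> 2 * b - 1" using swap(3) ab by presburger
  then have "evenperm (?s \<circ> ?t)" "permutation (?s \<circ> ?t)"
    using swap(3) by (simp_all add: evenperm_comp evenperm_swap permutation_swap_id permutation_compose)
  then show ?case
    using swap sibling_perm_comp[OF swap.hyps(4), of "transpose a b"]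
    by (simp only: st evenperm_comp permutation_compose simp_thms)
qed

text \<open>Without active vertices on level \<open>n\<close>, left children go to left children and
  right to right, so siblings on level \<open>Suc n\<close> move in blocks.\<close>

lemma portrait_perm_even:
  assumes "\<And>i. (n, i) \<notin> A"
  shows "evenperm (portrait_perm A (Suc n))"
proof -
  have "portrait_perm A (Suc n) x = sibling_perm (portrait_perm A n) x" for x
  proof (cases "x \<in> {1..2 ^ Suc n}")
    case True
    have "portrait_map A (Suc n) x = 2 * portrait_map A n ((x + 1) div 2) - x mod 2"
      using assms by (cases "odd x") (auto simp: Let_def mod_2_eq_odd)
    then show ?thesis
      using True parent_index[OF True] by (simp add: portrait_perm_def sibling_perm_def del: portrait_map.simps)
  next
    case False
    then have "(x + 1) div 2 \<notin> {1..2 ^ n}" by auto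
    then have "sibling_perm (portrait_perm A n) x = 2 * ((x + 1) div 2) - x mod 2"
      by (simp only: sibling_perm_def portrait_perm_def if_False)
    also have "\<dots> = x" by presburger
    finally show ?thesis using False by (simp only: portrait_perm_def if_False)
  qed
  then have "portrait_perm A (Suc n) = sibling_perm (portrait_perm A n)" by blast
  then show ?thesis using sibling_perm_even[OF portrait_perm_permutes] by simp
qed

text \<open>Each active vertex on level \<open>n\<close> swaps its two children, and nothing else
  moves. As \<open>n \<ge> 1\<close>, the two vertices are distinct, which gives a product of two
  transpositions.\<close>

lemma tau_portrait_perm_even:
  assumes "n \<ge> 1"
  shows "evenperm (portrait_perm {(n, 1), (n, 2 ^ n)} (Suc n))"
proof -
  define N :: nat where "N = 2 ^ n"
  let ?A = "{(n, 1), (n, N)}" and ?s = "transpose 1 2" and ?t = "transpose (2 * N - 1) (2 * N)"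
  have N: "N \<ge> 2" using assms power_increasing[of 1 n "2::nat"] by (simp add: N_def)
  have "portrait_perm ?A (Suc n) x = (?s \<circ> ?t) x" for x
  proof (cases "x \<in> {1..2 * N}")
    case True
    define p where "p = (x + 1) div 2"
    have "p \<in> {1..2 ^ n}" using True by (auto simp: p_def N_def)
    then have "portrait_map ?A n p = p" by (intro portrait_map_id) auto
    moreover have "portrait_map ?A (Suc n) x =
        (if odd x \<longleftrightarrow> (n, p) \<in> ?A then 2 * portrait_map ?A n p else 2 * portrait_map ?A n p - 1)"
      by (simp only: portrait_map.simps Let_def p_def)
    moreover have "x \<in> {1..2 ^ Suc n}" using True by (simp add: N_def)
    ultimately have val: "portrait_perm ?A (Suc n) x =
        (if odd x \<longleftrightarrow> p = 1 \<or> p = N then 2 * p else 2 * p - 1)"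
      by (simp only: portrait_perm_def if_True insert_iff empty_iff prod.inject simp_thms)
    show ?thesis
    proof (cases "odd x")
      case odd: True
      then have "x = 2 * p - 1" "p \<ge> 1" using True unfolding p_def by presburger+
      then show ?thesis unfolding val using odd N by (auto simp: transpose_def; presburger?)
    next
      case even: False
      then have "x = 2 * p" unfolding p_def by presburger
      then show ?thesis unfolding val using even N True by (auto simp: transpose_def; presburger?)
    qed
  next
    case False
    then show ?thesis using N by (auto simp: portrait_perm_def transpose_def N_def)
  qed
  then have "portrait_perm ?A (Suc n) = ?s \<circ> ?t" by blast
  moreover have "2 * N - 1 \<noteq> 2 * N" using N by simp
  ultimately have "evenperm (portrait_perm ?A (Suc n))"
    by (simp add: evenperm_comp evenperm_swap permutation_swap_id)
  then show ?thesis by (simp add: N_def)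
qed

lemma leaf_perm_S_alpha:
  assumes k: "k \<ge> 2"
  shows "leaf_perm k ` S_alpha k \<subseteq> carrier (alt_group (2 ^ k))"
proof -
  define n where "n = k - 1"
  have n: "n \<ge> 1" "k = Suc n" using k by (auto simp: n_def)
  have "evenperm (leaf_perm k (alpha k l))" if "l \<le> k - 2" for l
  proof -
    have "alpha k l \<in> tree_auts k" "active_vertices k (alpha k l) = {(l, 1)}"
      unfolding alpha_def using that k by (intro aut_with_portrait; auto)+
    \<comment> \<open>Since \<open>l \<le> k - 2\<close>, the last level of states,
      \<open>n = k - 1\<close>, has no active vertex.\<close>
    moreover have "evenperm (portrait_perm {(l, 1)} k)"
      unfolding n(2) using that n by (intro portrait_perm_even) auto
    ultimately show ?thesis by (simp add: leaf_perm_eq)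
  qed
  moreover have "evenperm (leaf_perm k (tau k))"
  proof -
    have "tau k \<in> tree_auts k" "active_vertices k (tau k) = {(n, 1), (n, 2 ^ n)}"
      unfolding tau_def n_def using k by (intro aut_with_portrait; auto)+
    then show ?thesis using tau_portrait_perm_even[OF n(1)] n(2) by (simp add: leaf_perm_eq)
  qed
  ultimately have "evenperm (leaf_perm k s)" if "s \<in> S_alpha k" for s
    using that by (auto simp: S_alpha_def)
  moreover have "leaf_perm k s permutes {1..2 ^ k}" if "s \<in> S_alpha k" for s
    using that S_alpha_subset[OF k] group_hom.hom_closed[OF leaf_perm_hom, of s k]
    by (auto simp: sym_group_carrier)
  ultimately show ?thesis by (auto simp: alt_group_carrier)
qed


section \<open>Orders\<close>

text \<open>Legendre's formula for the prime 2 in recursive form. Passing from \<open>n\<close> to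
  \<open>Suc n\<close> multiplies \<open>fact (2 * n)\<close> by
  \<open>2 * Suc n * (2 * n + 1)\<close>, whose last factor is odd.\<close>

lemma multiplicity_2_fact_double: "multiplicity 2 (fact (2 * n) :: nat) = n + multiplicity 2 (fact n :: nat)"
proof (induction n)
  case (Suc n)
  have m2: "multiplicity 2 (2 * a) = Suc (multiplicity 2 a)" if "a > 0" for a :: nat
    using that by (intro multiplicity_times_same) auto
  have mult: "multiplicity 2 (a * b) = multiplicity 2 a + multiplicity 2 b" if "a > 0" "b > 0" for a b :: nat
    using that by (intro prime_elem_multiplicity_mult_distrib) auto
  have odd: "multiplicity 2 (2 * n + 1) = 0" by (rule not_dvd_imp_multiplicity_0) simp
  have "fact (2 * Suc n) = 2 * (Suc n * ((2 * n + 1) * fact (2 * n)) :: nat)"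
    by (simp add: algebra_simps)
  then have "multiplicity 2 (fact (2 * Suc n) :: nat) =
      Suc (multiplicity 2 (Suc n * ((2 * n + 1) * fact (2 * n))))"
    using m2[of "Suc n * ((2 * n + 1) * fact (2 * n))"] by (simp del: mult_Suc mult_Suc_right fact_Suc)
  also have "\<dots> = Suc (multiplicity 2 (Suc n) + (multiplicity 2 (2 * n + 1) + multiplicity 2 (fact (2 * n) :: nat)))"
    by (subst mult[of "Suc n"], simp, simp, subst mult, simp_all)
  also have "\<dots> = Suc n + (multiplicity 2 (Suc n) + multiplicity 2 (fact n :: nat))"
    using Suc odd by simp
  also have "multiplicity 2 (Suc n) + multiplicity 2 (fact n :: nat) = multiplicity 2 (fact (Suc n) :: nat)"
    using mult[of "Suc n" "fact n"] by (simp del: mult_Suc mult_Suc_right)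
  finally show ?case .
qed simp

lemma multiplicity_2_fact_power: "multiplicity 2 (fact (2 ^ k) :: nat) = 2 ^ k - 1"
proof (induction k)
  case (Suc k)
  have "multiplicity 2 (fact (2 ^ Suc k) :: nat) = 2 ^ k + (2 ^ k - 1)"
    using multiplicity_2_fact_double[of "2 ^ k"] Suc by simp
  then show ?case by simp
qed simp

lemma order_alt_group: "k \<ge> 2 \<Longrightarrow> 2 * order (alt_group (2 ^ k)) = fact (2 ^ k)"
  using alt_group_card_carrier[of "2 ^ k"] power_increasing[of 1 k "2::nat"] by (simp add: order_def)

lemma multiplicity_order_alt_group:
  assumes "k \<ge> 2"
  shows "multiplicity 2 (order (alt_group (2 ^ k))) = 2 ^ k - 2"
proof -
  let ?o = "order (alt_group (2 ^ k))"
  have "?o \<noteq> 0" using order_alt_group[OF assms] by (metis fact_nonzero mult_0_right)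
  then have "multiplicity 2 (2 * ?o) = Suc (multiplicity 2 ?o)"
    by (intro multiplicity_times_same) auto
  then show ?thesis using order_alt_group[OF assms] multiplicity_2_fact_power[of k] by simp
qed

theorem theorem2:
  fixes k :: nat
  assumes "k \<ge> 2"
  shows "\<exists>P. sylow_subgroup 2 (alt_group (2 ^ k)) P \<and>
             G_alpha k \<cong> (alt_group (2 ^ k))\<lparr>carrier := P\<rparr>"
proof -
  interpret L: group_hom "tree_aut_group k" "sym_group (2 ^ k)" "leaf_perm k" by (rule leaf_perm_hom)
  let ?G = "generate (tree_aut_group k) (S_alpha k)" and ?Alt = "alt_group (2 ^ k)"
  define P where "P = leaf_perm k ` ?G"
  have S: "S_alpha k \<subseteq> carrier (tree_aut_group k)" by (rule S_alpha_subset[OF assms])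
  have G: "subgroup ?G (tree_aut_group k)" by (rule group.generate_is_subgroup[OF group_tree_aut_group S])
  \<comment> \<open>The image is generated by the images of the generators, which are even, and so
    lies in the alternating group.\<close>
  have "P = generate (sym_group (2 ^ k)) (leaf_perm k ` S_alpha k)"
    using L.generate_img[OF S] by (simp add: P_def)
  then have "P \<subseteq> carrier ?Alt"
    using L.H.generate_subgroup_incl[OF leaf_perm_S_alpha[OF assms] alt_group_is_subgroup] by simp
  then have P: "subgroup P ?Alt"
    using L.H.subgroup_incl[OF L.subgroup_img_is_subgroup[OF G] alt_group_is_subgroup]
    by (simp add: P_def alt_group_def)
  have inj: "inj_on (leaf_perm k) ?G"
    using leaf_perm_inj generate_subset[OF assms] by (rule inj_on_subset)
  have card: "card P = card ?G" unfolding P_def by (rule card_image[OF inj])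
  have "card ?G dvd 2 ^ (2 ^ k - 1)"
    using group.lagrange[OF group_tree_aut_group G] card_tree_auts[of k] by (metis dvd_triv_right order_def partial_object.select_convs(1) tree_aut_group_def)
  then obtain m where m: "card ?G = 2 ^ m"
    using divides_primepow_nat[OF two_is_prime_nat] by blast
  \<comment> \<open>Lagrange's theorem in the alternating group bounds \<open>m\<close> from above;
    the count of portraits then bounds it from below by the same number.\<close>
  have "card P dvd order ?Alt"
    using group.lagrange[OF alt_group_is_group P] by (metis dvd_triv_right)
  moreover have "order ?Alt \<noteq> 0"
    using order_alt_group[OF assms] by (metis fact_nonzero mult_0_right)
  ultimately have "m \<le> 2 ^ k - 2"
    using multiplicity_geI[of "order ?Alt" 2 m] multiplicity_order_alt_group[OF assms] card m by simp
  moreover have "2 ^ k - 2 \<le> m"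
    using card_generate_ge[OF assms] m by simp
  ultimately have "sylow_subgroup 2 ?Alt P"
    using P card m multiplicity_order_alt_group[OF assms] by (simp add: sylow_subgroup_def)
  moreover have "leaf_perm k \<in> iso (G_alpha k) (?Alt\<lparr>carrier := P\<rparr>)"
  proof (rule isoI)
    show "leaf_perm k \<in> hom (G_alpha k) (?Alt\<lparr>carrier := P\<rparr>)"
      using L.hom_mult subgroup.mem_carrier[OF G]
      by (intro homI) (auto simp: G_alpha_def P_def alt_group_def)
    show "bij_betw (leaf_perm k) (carrier (G_alpha k)) (carrier (?Alt\<lparr>carrier := P\<rparr>))"
      using inj by (simp add: bij_betw_def G_alpha_def P_def)
  qed
  ultimately show ?thesis unfolding is_iso_def by blast
qed

end
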